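(* $\mathbf{S4DS}$ is the D-logic of the class of all dense-in-itself topological spaces; that is, for every bimodal formula $A$, one has $A\in\mathbf{S4DS}$ if and only if $A$ is valid in every dense-in-itself topological space.
   Context: Formulas are built by $\phi ::= p \mid \bot \mid \phi\to\phi \mid \Box\phi \mid [\neq]\phi$, with $p$ ranging over propositional letters; the other Boolean connectives are the usual abbreviations, $\Diamond A=\neg\Box\neg A$, $\langle\neq\rangle A=\neg[\neq]\neg A$, and $[\forall]A=[\neq]A\wedge A$. A (bimodal) logic is a set of formulas containing all classical tautologies, $\Box(p\to q)\to(\Box p\to\Box q)$ and $[\neq](p\to q)\to([\neq]p\to[\neq]q)$, and closed under Substitution, Modus Ponens, and the two Generalization rules $A/\Box A$ and $A/[\neq]A$. $\mathbf{K_2}$ is the minimal logic, and $L+\Gamma$ is the minimal logic containing the logic $L$ and the set of formulas $\Gamma$. $\mathbf{S4D}=\mathbf{K_2}+\{B_D,4_D^-,D_\Box,T_\Box,4_\Box\}$ and $\mathbf{S4DS}=\mathbf{S4D}+DS$, where $B_D$ is $p\to[\neq]\langle\neq\rangle p$; $4_D^-$ is $(p\wedge[\neq]p)\to[\neq][\neq]p$; $D_\Box$ is $[\forall]p\to\Box p$; $T_\Box$ is $\Box p\to p$; $4_\Box$ is $\Box p\to\Box\Box p$; $DS$ is $[\neq]p\to\Diamond p$. Topological semantics: a valuation $\theta$ on a topological space $\mathfrak X$ assigns to each propositional letter a subset of $\mathfrak X$. Truth at a point is defined by: $\mathfrak X,\theta,x\models p$ iff $x\in\theta(p)$; $\bot$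 is never true; $\to$ is interpreted classically; $\mathfrak X,\theta,x\models\Box\phi$ iff there is a neighborhood $U$ of $x$ with $\mathfrak X,\theta,y\models\phi$ for all $y\in U$; $\mathfrak X,\theta,x\models[\neq]\phi$ iff $\mathfrak X,\theta,y\models\phi$ for all $y\neq x$. A formula is valid in $\mathfrak X$ if it is true at every point under every valuation. The D-logic of a class of spaces is the set of all formulas valid in all spaces of the class. A point $x$ of $\mathfrak X$ is isolated if $\{x\}$ is open; $\mathfrak X$ is dense-in-itself if it has no isolated points. *)

theory Defs
  imports "HOL-Analysis.Abstract_Topology"
begin

type_synonym letter = nat

datatype fm =
    Letter letter
  | Bot  (\<open>\<bottom>\<^sub>f\<close>)
  | Imp fm fm  (infixr \<open>\<rightarrow>\<^sub>f\<close> 25)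
  | Box fm  (\<open>\<box> _\<close> [60] 60)
  | BoxD fm  (\<open>[\<noteq>] _\<close> [60] 60)

abbreviation Neg :: "fm \<Rightarrow> fm"  (\<open>\<not>\<^sub>f _\<close> [60] 60) where
  "\<not>\<^sub>f A \<equiv> A \<rightarrow>\<^sub>f \<bottom>\<^sub>f"

abbreviation Conj :: "fm \<Rightarrow> fm \<Rightarrow> fm"  (infixr \<open>\<and>\<^sub>f\<close> 35) where
  "A \<and>\<^sub>f B \<equiv> \<not>\<^sub>f (A \<rightarrow>\<^sub>f \<not>\<^sub>f B)"

abbreviation Dia :: "fm \<Rightarrow> fm"  (\<open>\<diamond> _\<close> [60] 60) where
  "\<diamond> A \<equiv> \<not>\<^sub>f \<box> \<not>\<^sub>f A"

abbreviation DiaD :: "fm \<Rightarrow> fm"  (\<open>\<langle>\<noteq>\<rangle> _\<close> [60] 60) where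
  "\<langle>\<noteq>\<rangle> A \<equiv> \<not>\<^sub>f [\<noteq>] \<not>\<^sub>f A"

abbreviation BoxA :: "fm \<Rightarrow> fm"  (\<open>[\<forall>] _\<close> [60] 60) where
  "[\<forall>] A \<equiv> [\<noteq>] A \<and>\<^sub>f A"

primrec subst :: "(letter \<Rightarrow> fm) \<Rightarrow> fm \<Rightarrow> fm" where
  "subst \<sigma> (Letter p) = \<sigma> p"
| "subst \<sigma> \<bottom>\<^sub>f = \<bottom>\<^sub>f"
| "subst \<sigma> (A \<rightarrow>\<^sub>f B) = (subst \<sigma> A \<rightarrow>\<^sub>f subst \<sigma> B)"
| "subst \<sigma> (\<box> A) = \<box> (subst \<sigma> A)"
| "subst \<sigma> ([\<noteq>] A) = [\<noteq>] (subst \<sigma> A)"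

text \<open>Classical tautologies are taken in the bimodal language: letters and formulas starting
  with a modality are the propositional atoms.  Since logics are closed under substitution, they
  contain these formulas iff they contain the modality-free ones.\<close>

primrec prop_eval :: "(fm \<Rightarrow> bool) \<Rightarrow> fm \<Rightarrow> bool" where
  "prop_eval v (Letter p) = v (Letter p)"
| "prop_eval v \<bottom>\<^sub>f = False"
| "prop_eval v (A \<rightarrow>\<^sub>f B) = (prop_eval v A \<longrightarrow> prop_eval v B)"
| "prop_eval v (\<box> A) = v (\<box> A)"
| "prop_eval v ([\<noteq>] A) = v ([\<noteq>] A)"

definition tautology :: "fm \<Rightarrow> bool" where
  "tautology A \<longleftrightarrow> (\<forall>v. prop_eval v A)"

abbreviation P :: fm where "P \<equiv> Letter 0"
abbreviation Q :: fm where "Q \<equiv> Letter 1"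

definition bimodal_logic :: "fm set \<Rightarrow> bool" where
  "bimodal_logic L \<longleftrightarrow>
     (\<forall>A. tautology A \<longrightarrow> A \<in> L) \<and>
     (\<box> (P \<rightarrow>\<^sub>f Q) \<rightarrow>\<^sub>f (\<box> P \<rightarrow>\<^sub>f \<box> Q)) \<in> L \<and>
     ([\<noteq>] (P \<rightarrow>\<^sub>f Q) \<rightarrow>\<^sub>f ([\<noteq>] P \<rightarrow>\<^sub>f [\<noteq>] Q)) \<in> L \<and>
     (\<forall>\<sigma> A. A \<in> L \<longrightarrow> subst \<sigma> A \<in> L) \<and>
     (\<forall>A B. (A \<rightarrow>\<^sub>f B) \<in> L \<longrightarrow> A \<in> L \<longrightarrow> B \<in> L) \<and>
     (\<forall>A. A \<in> L \<longrightarrow> \<box> A \<in> L) \<and>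
     (\<forall>A. A \<in> L \<longrightarrow> [\<noteq>] A \<in> L)"

text \<open>The defining conditions of a logic are preserved by intersections, so the minimal logic
  with a given lower bound is the intersection of all of them.\<close>

definition K2 :: "fm set" where
  "K2 = \<Inter> {L. bimodal_logic L}"

definition extend :: "fm set \<Rightarrow> fm set \<Rightarrow> fm set"  (infixl \<open>\<oplus>\<^sub>L\<close> 65) where
  "L \<oplus>\<^sub>L \<Gamma> = \<Inter> {M. bimodal_logic M \<and> L \<subseteq> M \<and> \<Gamma> \<subseteq> M}"

definition ax_B_D :: fm where "ax_B_D = (P \<rightarrow>\<^sub>f [\<noteq>] \<langle>\<noteq>\<rangle> P)"
definition ax_4_D :: fm where "ax_4_D = ((P \<and>\<^sub>f [\<noteq>] P) \<rightarrow>\<^sub>f [\<noteq>] [\<noteq>] P)"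
definition ax_D_Box :: fm where "ax_D_Box = ([\<forall>] P \<rightarrow>\<^sub>f \<box> P)"
definition ax_T_Box :: fm where "ax_T_Box = (\<box> P \<rightarrow>\<^sub>f P)"
definition ax_4_Box :: fm where "ax_4_Box = (\<box> P \<rightarrow>\<^sub>f \<box> \<box> P)"
definition ax_DS :: fm where "ax_DS = ([\<noteq>] P \<rightarrow>\<^sub>f \<diamond> P)"

definition S4D :: "fm set" where
  "S4D = K2 \<oplus>\<^sub>L {ax_B_D, ax_4_D, ax_D_Box, ax_T_Box, ax_4_Box}"

definition S4DS :: "fm set" where
  "S4DS = S4D \<oplus>\<^sub>L {ax_DS}"

definition nbhd :: "'a topology \<Rightarrow> 'a \<Rightarrow> 'a set \<Rightarrow> bool" where
  "nbhd X x U \<longleftrightarrow> U \<subseteq> topspace X \<and> (\<exists>V. openin X V \<and> x \<in> V \<and> V \<subseteq> U)"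

text \<open>Truth is only meaningful at points of the carrier \<open>topspace X\<close>.\<close>

primrec holds :: "'a topology \<Rightarrow> (letter \<Rightarrow> 'a set) \<Rightarrow> 'a \<Rightarrow> fm \<Rightarrow> bool" where
  "holds X \<theta> x (Letter p) \<longleftrightarrow> x \<in> \<theta> p"
| "holds X \<theta> x \<bottom>\<^sub>f \<longleftrightarrow> False"
| "holds X \<theta> x (A \<rightarrow>\<^sub>f B) \<longleftrightarrow> (holds X \<theta> x A \<longrightarrow> holds X \<theta> x B)"
| "holds X \<theta> x (\<box> A) \<longleftrightarrow> (\<exists>U. nbhd X x U \<and> (\<forall>y\<in>U. holds X \<theta> y A))"
| "holds X \<theta> x ([\<noteq>] A) \<longleftrightarrow> (\<forall>y\<in>topspace X. y \<noteq> x \<longrightarrow> holds X \<theta> y A)"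

definition valuation :: "'a topology \<Rightarrow> (letter \<Rightarrow> 'a set) \<Rightarrow> bool" where
  "valuation X \<theta> \<longleftrightarrow> (\<forall>p. \<theta> p \<subseteq> topspace X)"

definition valid_in :: "'a topology \<Rightarrow> fm \<Rightarrow> bool" where
  "valid_in X A \<longleftrightarrow> (\<forall>\<theta>. valuation X \<theta> \<longrightarrow> (\<forall>x\<in>topspace X. holds X \<theta> x A))"

text \<open>HOL cannot quantify over all types inside a formula.  A space is a topology on an arbitrary
  subset of a type, so over an infinite type a class such as the dense-in-itself spaces contains,
  up to homeomorphism, every space whose cardinality does not exceed that of the type.\<close>

definition D_logic :: "'a topology set \<Rightarrow> fm set" where
  "D_logic C = {A. \<forall>X\<in>C. valid_in X A}"

definition isolated_pt :: "'a topology \<Rightarrow> 'a \<Rightarrow> bool" where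
  "isolated_pt X x \<longleftrightarrow> x \<in> topspace X \<and> openin X {x}"

definition dense_in_itself :: "'a topology \<Rightarrow> bool" where
  "dense_in_itself X \<longleftrightarrow> \<not> (\<exists>x. isolated_pt X x)"

end

theory Submission
  imports Defs "HOL-Library.Countable_Set"
begin

text \<open>Completeness goes through the canonical model.  A non-theorem fails in some maximal
  consistent set; closing it under witnesses for both boxes and for \<open>DS\<close> (a point related to the
  given one by both accessibility relations) gives a countable submodel in which any two distinct
  points are related by the relation of \<open>[\<noteq>]\<close>.  Doubling every point that is reflexive for this
  relation turns it into the true inequality.  With the up-sets of the preorder of \<open>\<box>\<close> as open
  sets, the result is a space, and the \<open>DS\<close>-witnesses say that no point of it is isolated.
  Countability lets the space live on a subset of any infinite type.\<close>

instance fm :: countable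
  by countable_datatype

section \<open>Soundness\<close>

text \<open>Truth at one fixed point is itself a Boolean valuation of letters and boxed formulas,
  which makes tautologies valid.\<close>

lemma prop_eval_holds: "prop_eval (holds X \<theta> x) A = holds X \<theta> x A"
  by (induction A) auto

text \<open>Substituting is a change of valuation. Cutting the truth sets down to the carrier makes
  the new assignment a \<open>valuation\<close>; the induction stays on the carrier because
  neighbourhoods lie in it.\<close>

lemma holds_subst:
  assumes "x \<in> topspace X"
  shows "holds X \<theta> x (subst \<sigma> A)
     \<longleftrightarrow> holds X (\<lambda>p. {y \<in> topspace X. holds X \<theta> y (\<sigma> p)}) x A"
  using assms
proof (induction A arbitrary: x)
  case (Box A)
  have "U \<subseteq> topspace X" if "nbhd X x U" for U
    using that by (simp add: nbhd_def)
  then show ?case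
    using Box.IH by (simp, blast)
qed auto

lemma bimodal_logic_D_logic: "bimodal_logic (D_logic C)"
proof -
  have taut: "valid_in X A" if "tautology A" for X :: "'a topology" and A
    using that by (metis prop_eval_holds tautology_def valid_in_def)
  have K_Box: "valid_in X (\<box> (P \<rightarrow>\<^sub>f Q) \<rightarrow>\<^sub>f (\<box> P \<rightarrow>\<^sub>f \<box> Q))" for X :: "'a topology"
  proof -
    \<comment> \<open>Neighbourhoods witnessing the two boxed premises are merged into one, on which
      both formulas hold.\<close>
    have "nbhd X x (U \<inter> V)" if U: "nbhd X x U" and V: "nbhd X x V" for x U V
    proof -
      obtain U' V' where "openin X U'" "x \<in> U'" "U' \<subseteq> U" "openin X V'" "x \<in> V'" "V' \<subseteq> V"
        using U V unfolding nbhd_def by blast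
      then have "openin X (U' \<inter> V') \<and> x \<in> U' \<inter> V' \<and> U' \<inter> V' \<subseteq> U \<inter> V"
        by auto
      moreover have "U \<inter> V \<subseteq> topspace X"
        using U by (auto simp: nbhd_def)
      ultimately show ?thesis
        unfolding nbhd_def by blast
    qed
    then show ?thesis
      unfolding valid_in_def by simp (metis IntE)
  qed
  have K_BoxD: "valid_in X ([\<noteq>] (P \<rightarrow>\<^sub>f Q) \<rightarrow>\<^sub>f ([\<noteq>] P \<rightarrow>\<^sub>f [\<noteq>] Q))" for X :: "'a topology"
    by (simp add: valid_in_def)
  have subst: "valid_in X (subst \<sigma> A)" if A: "valid_in X A" for X :: "'a topology" and \<sigma> A
    unfolding valid_in_def
  proof (intro allI impI ballI)
    fix \<theta> x assume x: "x \<in> topspace X"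
    have "valuation X (\<lambda>p. {y \<in> topspace X. holds X \<theta> y (\<sigma> p)})"
      by (auto simp: valuation_def)
    then show "holds X \<theta> x (subst \<sigma> A)"
      using A x by (simp add: holds_subst valid_in_def)
  qed
  have mp: "valid_in X B" if "valid_in X (A \<rightarrow>\<^sub>f B)" "valid_in X A" for X :: "'a topology" and A B
    using that by (auto simp: valid_in_def)
  have nec_Box: "valid_in X (\<box> A)" if "valid_in X A" for X :: "'a topology" and A
  proof -
    have "nbhd X x (topspace X)" if "x \<in> topspace X" for x
      using that by (auto simp: nbhd_def)
    then show ?thesis
      using that unfolding valid_in_def by simp blast
  qed
  have nec_BoxD: "valid_in X ([\<noteq>] A)" if "valid_in X A" for X :: "'a topology" and A
    using that by (auto simp: valid_in_def)
  show ?thesis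
    unfolding bimodal_logic_def D_logic_def
    using taut K_Box K_BoxD subst mp nec_Box nec_BoxD by (simp, blast)
qed

text \<open>Inequality is symmetric, which gives \<open>ax_B_D\<close>; two inequality steps lead
  back to the start or to a point different from it, which gives \<open>ax_4_D\<close>. For
  \<open>ax_D_Box\<close> the whole carrier is a neighbourhood, and for \<open>ax_4_Box\<close> a
  neighbourhood of \<open>x\<close> is one of every point of the open set inside it.\<close>

lemma valid_in_S4D_axioms:
  "valid_in X ax_B_D" "valid_in X ax_4_D" "valid_in X ax_D_Box" "valid_in X ax_T_Box"
  "valid_in X ax_4_Box"
proof -
  show "valid_in X ax_B_D"
    unfolding valid_in_def ax_B_D_def by simp metis
  show "valid_in X ax_4_D"
    by (auto simp: valid_in_def ax_4_D_def)
  show "valid_in X ax_D_Box"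
    unfolding valid_in_def ax_D_Box_def
  proof (intro allI impI ballI)
    fix \<theta> x assume "x \<in> topspace X"
    then have "nbhd X x (topspace X)"
      by (auto simp: nbhd_def)
    then have "holds X \<theta> x (\<box> P)" if "\<forall>y\<in>topspace X. y \<in> \<theta> 0"
      using that by auto
    moreover have "\<forall>y\<in>topspace X. y \<in> \<theta> 0" if "holds X \<theta> x ([\<forall>] P)"
    proof
      fix y assume "y \<in> topspace X"
      then show "y \<in> \<theta> 0"
        using that by (cases "y = x") simp_all
    qed
    ultimately show "holds X \<theta> x ([\<forall>] P \<rightarrow>\<^sub>f \<box> P)"
      unfolding holds.simps(3)[of _ _ _ "[\<forall>] P"] by blast
  qed
  show "valid_in X ax_T_Box"
    by (auto simp: valid_in_def ax_T_Box_def nbhd_def)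
  show "valid_in X ax_4_Box"
    unfolding valid_in_def ax_4_Box_def holds.simps(3)
  proof (intro allI impI ballI)
    fix \<theta> x assume "holds X \<theta> x (\<box> P)"
    then obtain U where U: "nbhd X x U" "\<forall>y\<in>U. holds X \<theta> y P"
      by auto
    then obtain V where V: "openin X V" "x \<in> V" "V \<subseteq> U" "U \<subseteq> topspace X"
      unfolding nbhd_def by blast
    then have "nbhd X x V" and "\<forall>y\<in>V. nbhd X y U"
      unfolding nbhd_def by blast+
    then show "holds X \<theta> x (\<box> \<box> P)"
      using U(2) unfolding holds.simps(4) by blast
  qed
qed

text \<open>Every neighbourhood of \<open>x\<close> contains an open set around \<open>x\<close>
  that is not \<open>{x}\<close>, hence a second point, where \<open>[\<noteq>] P\<close> makes
  \<open>P\<close> true.\<close>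

lemma valid_in_DS:
  assumes "dense_in_itself X"
  shows "valid_in X ax_DS"
proof -
  have "\<exists>y\<in>U. y \<in> topspace X \<and> y \<noteq> x" if U: "nbhd X x U" for x U
  proof -
    obtain V where V: "openin X V" "x \<in> V" "V \<subseteq> U" "U \<subseteq> topspace X"
      using U unfolding nbhd_def by blast
    then have "V \<noteq> {x}"
      using assms unfolding dense_in_itself_def isolated_pt_def by auto
    then show ?thesis
      using V by blast
  qed
  then show ?thesis
    unfolding valid_in_def ax_DS_def by simp metis
qed

section \<open>Minimal logics\<close>

lemma bimodal_logic_Inter:
  assumes "\<And>L. L \<in> \<L> \<Longrightarrow> bimodal_logic L"
  shows "bimodal_logic (\<Inter>\<L>)"
  unfolding bimodal_logic_def
proof (intro conjI allI impI InterI)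
  fix L assume "L \<in> \<L>"
  then have L: "bimodal_logic L" and sub: "\<Inter>\<L> \<subseteq> L"
    using assms by auto
  note L = L[unfolded bimodal_logic_def]
  show "A \<in> L" if "tautology A" for A
    using L that by blast
  show "(\<box> (P \<rightarrow>\<^sub>f Q) \<rightarrow>\<^sub>f (\<box> P \<rightarrow>\<^sub>f \<box> Q)) \<in> L"
    "([\<noteq>] (P \<rightarrow>\<^sub>f Q) \<rightarrow>\<^sub>f ([\<noteq>] P \<rightarrow>\<^sub>f [\<noteq>] Q)) \<in> L"
    using L by blast+
  show "subst \<sigma> A \<in> L" "\<box> A \<in> L" "[\<noteq>] A \<in> L" if "A \<in> \<Inter>\<L>" for \<sigma> A
    using L sub that by blast+
  show "B \<in> L" if "(A \<rightarrow>\<^sub>f B) \<in> \<Inter>\<L>" "A \<in> \<Inter>\<L>" for A B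
    using L sub that by blast
qed

lemma bimodal_logic_extend: "bimodal_logic (L \<oplus>\<^sub>L \<Gamma>)"
  unfolding extend_def by (rule bimodal_logic_Inter) simp

lemma extend_upper: "L \<subseteq> L \<oplus>\<^sub>L \<Gamma>" "\<Gamma> \<subseteq> L \<oplus>\<^sub>L \<Gamma>"
  unfolding extend_def by blast+

lemma extend_least: "bimodal_logic M \<Longrightarrow> L \<subseteq> M \<Longrightarrow> \<Gamma> \<subseteq> M \<Longrightarrow> L \<oplus>\<^sub>L \<Gamma> \<subseteq> M"
  unfolding extend_def by blast

lemma K2_least: "bimodal_logic M \<Longrightarrow> K2 \<subseteq> M"
  unfolding K2_def by blast

text \<open>Minimality is applied layer by layer: the D-logic is a logic, so it contains
  \<open>K2\<close>, and with the axioms also \<open>S4D\<close> and \<open>S4DS\<close>.\<close>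

lemma S4DS_sound: "S4DS \<subseteq> D_logic {X. dense_in_itself X}"
  unfolding S4DS_def S4D_def
  by (intro extend_least K2_least bimodal_logic_D_logic)
    (auto simp: D_logic_def valid_in_S4D_axioms valid_in_DS)

section \<open>Maximal consistent sets\<close>

text \<open>Nested implications replace a finite conjunction of premises, so that distributivity of
  a box can strip the premises one by one.\<close>

definition imps :: "fm list \<Rightarrow> fm \<Rightarrow> fm" where
  "imps As B = foldr Imp As B"

lemma imps_simps [simp]: "imps [] B = B" "imps (A # As) B = (A \<rightarrow>\<^sub>f imps As B)"
  by (simp_all add: imps_def)

lemma prop_eval_imps [simp]:
  "prop_eval v (imps As B) \<longleftrightarrow> ((\<forall>A\<in>set As. prop_eval v A) \<longrightarrow> prop_eval v B)"
  by (induction As) auto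

text \<open>The canonical accessibility relation, with the box as a parameter so that it serves for
  both modalities.\<close>

definition rel :: "(fm \<Rightarrow> fm) \<Rightarrow> fm set \<Rightarrow> fm set \<Rightarrow> bool" where
  "rel M x y \<longleftrightarrow> (\<forall>A. M A \<in> x \<longrightarrow> A \<in> y)"

locale modal_logic =
  fixes L :: "fm set"
  assumes bimodal: "bimodal_logic L"
begin

lemma taut: "tautology A \<Longrightarrow> A \<in> L"
  and mp: "(A \<rightarrow>\<^sub>f B) \<in> L \<Longrightarrow> A \<in> L \<Longrightarrow> B \<in> L"
  and subst: "A \<in> L \<Longrightarrow> subst \<sigma> A \<in> L"
  using bimodal unfolding bimodal_logic_def by blast+

lemma taut_mp: "A \<in> L \<Longrightarrow> tautology (A \<rightarrow>\<^sub>f B) \<Longrightarrow> B \<in> L"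
  using taut mp by blast

section \<open>Derivability from premises\<close>

text \<open>Premises enter only as antecedents of a member of \<open>L\<close>; the generalization
  rules never apply to them, and so the deduction theorem holds.\<close>

definition derives :: "fm set \<Rightarrow> fm \<Rightarrow> bool" where
  "derives \<Gamma> B \<longleftrightarrow> (\<exists>As. set As \<subseteq> \<Gamma> \<and> imps As B \<in> L)"

lemma derives_theorem: "A \<in> L \<Longrightarrow> derives \<Gamma> A"
  unfolding derives_def by (rule exI[of _ "[]"]) simp

lemma derives_assm: "A \<in> \<Gamma> \<Longrightarrow> derives \<Gamma> A"
  unfolding derives_def by (rule exI[of _ "[A]"]) (simp add: taut tautology_def)

lemma derives_mp:
  assumes "derives \<Gamma> (A \<rightarrow>\<^sub>f B)" "derives \<Gamma> A"
  shows "derives \<Gamma> B"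
proof -
  obtain As Bs where As: "set As \<subseteq> \<Gamma>" "imps As (A \<rightarrow>\<^sub>f B) \<in> L"
    and Bs: "set Bs \<subseteq> \<Gamma>" "imps Bs A \<in> L"
    using assms unfolding derives_def by blast
  have "(imps Bs A \<rightarrow>\<^sub>f imps (As @ Bs) B) \<in> L"
    using As(2) by (rule taut_mp) (auto simp: tautology_def)
  then have "imps (As @ Bs) B \<in> L"
    using Bs(2) mp by blast
  then show ?thesis
    unfolding derives_def using As Bs by (intro exI[of _ "As @ Bs"]) simp
qed

lemma derives_taut: "derives \<Gamma> A \<Longrightarrow> tautology (A \<rightarrow>\<^sub>f B) \<Longrightarrow> derives \<Gamma> B"
  by (meson derives_mp derives_theorem taut)

lemma deduction:
  assumes "derives (insert A \<Gamma>) B"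
  shows "derives \<Gamma> (A \<rightarrow>\<^sub>f B)"
proof -
  obtain As where As: "set As \<subseteq> insert A \<Gamma>" "imps As B \<in> L"
    using assms unfolding derives_def by blast
  \<comment> \<open>All occurrences of \<open>A\<close> are dropped from the list and one is put
    back as the last antecedent, a propositionally sound rearrangement.\<close>
  have "imps (removeAll A As) (A \<rightarrow>\<^sub>f B) \<in> L"
    using As(2) by (rule taut_mp) (auto simp: tautology_def)
  then show ?thesis
    unfolding derives_def using As(1) by (intro exI[of _ "removeAll A As"]) auto
qed

definition consistent :: "fm set \<Rightarrow> bool" where
  "consistent \<Gamma> \<longleftrightarrow> \<not> derives \<Gamma> \<bottom>\<^sub>f"

definition mcs :: "fm set \<Rightarrow> bool" where
  "mcs x \<longleftrightarrow> consistent x \<and> (\<forall>A. A \<in> x \<or> \<not>\<^sub>f A \<in> x)"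

lemma mcs_closed: "mcs x \<Longrightarrow> derives x A \<Longrightarrow> A \<in> x"
  unfolding mcs_def consistent_def using derives_assm derives_mp by blast

lemma mcs_theorem: "mcs x \<Longrightarrow> A \<in> L \<Longrightarrow> A \<in> x"
  using derives_theorem mcs_closed by blast

lemma mcs_Bot: "mcs x \<Longrightarrow> \<bottom>\<^sub>f \<notin> x"
  unfolding mcs_def consistent_def using derives_assm by blast

lemma mcs_Imp:
  assumes "mcs x"
  shows "(A \<rightarrow>\<^sub>f B) \<in> x \<longleftrightarrow> (A \<in> x \<longrightarrow> B \<in> x)"
proof
  assume "(A \<rightarrow>\<^sub>f B) \<in> x"
  then show "A \<in> x \<longrightarrow> B \<in> x"
    using assms by (metis derives_assm derives_mp mcs_closed)
next
  assume *: "A \<in> x \<longrightarrow> B \<in> x"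
  show "(A \<rightarrow>\<^sub>f B) \<in> x"
  proof (cases "A \<in> x")
    case True
    then have "derives x B"
      using * derives_assm by blast
    then have "derives x (A \<rightarrow>\<^sub>f B)"
      by (rule derives_taut) (simp add: tautology_def)
    then show ?thesis
      using assms mcs_closed by blast
  next
    case False
    then have "derives x (\<not>\<^sub>f A)"
      using assms derives_assm unfolding mcs_def by blast
    then have "derives x (A \<rightarrow>\<^sub>f B)"
      by (rule derives_taut) (simp add: tautology_def)
    then show ?thesis
      using assms mcs_closed by blast
  qed
qed

lemma Lindenbaum:
  assumes "consistent \<Gamma>"
  obtains x where "mcs x" "\<Gamma> \<subseteq> x"
proof -
  let ?S = "{\<Delta>. \<Gamma> \<subseteq> \<Delta> \<and> consistent \<Delta>}"
  have chain: "\<Union>\<C> \<in> ?S" if \<C>: "\<C> \<noteq> {}" "subset.chain ?S \<C>" for \<C>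
  proof -
    have "\<not> derives (\<Union>\<C>) \<bottom>\<^sub>f"
    proof
      assume "derives (\<Union>\<C>) \<bottom>\<^sub>f"
      then obtain As where As: "set As \<subseteq> \<Union>\<C>" "imps As \<bottom>\<^sub>f \<in> L"
        unfolding derives_def by blast
      \<comment> \<open>Only finitely many premises occur, so a single member of the chain contains
        them all and would already be inconsistent.\<close>
      obtain \<Delta> where "\<Delta> \<in> \<C>" "set As \<subseteq> \<Delta>"
        using finite_subset_Union_chain[OF _ As(1) \<C>] by auto
      then show False
        using As(2) \<C>(2) unfolding subset.chain_def consistent_def derives_def by blast
    qed
    then show ?thesis
      using \<C> unfolding subset.chain_def consistent_def by blast
  qed
  have "?S \<noteq> {}"
    using assms by blast
  then obtain x where x: "x \<in> ?S" and max: "\<And>y. y \<in> ?S \<Longrightarrow> x \<subseteq> y \<Longrightarrow> y = x"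
    using subset_Zorn_nonempty[OF _ chain] by (metis (no_types, lifting))
  have "A \<in> x \<or> \<not>\<^sub>f A \<in> x" for A
  proof (rule ccontr)
    assume not: "\<not> (A \<in> x \<or> \<not>\<^sub>f A \<in> x)"
    \<comment> \<open>By maximality, adding \<open>B\<close> destroys consistency, so
      \<open>x\<close> refutes \<open>B\<close>. It cannot refute both \<open>A\<close> and its
      negation.\<close>
    have "derives x (B \<rightarrow>\<^sub>f \<bottom>\<^sub>f)" if "B \<notin> x" for B
      using max[of "insert B x"] x that deduction unfolding consistent_def by blast
    then have "derives x (A \<rightarrow>\<^sub>f \<bottom>\<^sub>f)" "derives x (\<not>\<^sub>f A \<rightarrow>\<^sub>f \<bottom>\<^sub>f)"
      using not by blast+
    then show False
      using x derives_mp unfolding consistent_def by blast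
  qed
  then show thesis
    using that x unfolding mcs_def by blast
qed

section \<open>Normal boxes and the existence of witnesses\<close>

definition normal_box :: "(fm \<Rightarrow> fm) \<Rightarrow> bool" where
  "normal_box M \<longleftrightarrow>
     (\<forall>A B. (M (A \<rightarrow>\<^sub>f B) \<rightarrow>\<^sub>f (M A \<rightarrow>\<^sub>f M B)) \<in> L) \<and> (\<forall>A\<in>L. M A \<in> L)"

lemma normal_box: "normal_box Box" "normal_box BoxD"
proof -
  have "(\<box> (A \<rightarrow>\<^sub>f B) \<rightarrow>\<^sub>f (\<box> A \<rightarrow>\<^sub>f \<box> B)) \<in> L"
    "([\<noteq>] (A \<rightarrow>\<^sub>f B) \<rightarrow>\<^sub>f ([\<noteq>] A \<rightarrow>\<^sub>f [\<noteq>] B)) \<in> L" for A B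
    using subst[of "\<box> (P \<rightarrow>\<^sub>f Q) \<rightarrow>\<^sub>f (\<box> P \<rightarrow>\<^sub>f \<box> Q)" "\<lambda>p. if p = 0 then A else B"]
      subst[of "[\<noteq>] (P \<rightarrow>\<^sub>f Q) \<rightarrow>\<^sub>f ([\<noteq>] P \<rightarrow>\<^sub>f [\<noteq>] Q)" "\<lambda>p. if p = 0 then A else B"]
      bimodal unfolding bimodal_logic_def by simp_all
  then show "normal_box Box" "normal_box BoxD"
    using bimodal unfolding normal_box_def bimodal_logic_def by blast+
qed

lemma mcs_box_derives:
  assumes "normal_box M" "mcs x" "derives {A. M A \<in> x} B"
  shows "M B \<in> x"
proof -
  obtain As where "set As \<subseteq> {A. M A \<in> x}" "imps As B \<in> L"
    using assms(3) unfolding derives_def by blast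
  \<comment> \<open>The induction assumes the boxed implication in \<open>x\<close> rather than the
    implication in \<open>L\<close>: once a premise is stripped, the rest need not be a
    theorem.\<close>
  moreover have "M B \<in> x" if "set As \<subseteq> {A. M A \<in> x}" "M (imps As B) \<in> x" for As
    using that
  proof (induction As)
    case (Cons A As)
    have "(M (A \<rightarrow>\<^sub>f imps As B) \<rightarrow>\<^sub>f (M A \<rightarrow>\<^sub>f M (imps As B))) \<in> x"
      using assms(1,2) mcs_theorem unfolding normal_box_def by blast
    then show ?case
      using Cons assms(2) by (simp add: mcs_Imp)
  qed simp
  ultimately show ?thesis
    using assms(1,2) mcs_theorem unfolding normal_box_def by blast
qed

lemma mcs_box_taut:
  assumes "normal_box M" "mcs x" "M A \<in> x" "tautology (A \<rightarrow>\<^sub>f B)"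
  shows "M B \<in> x"
  using assms(1,2)
  by (rule mcs_box_derives) (meson assms(3,4) derives_assm derives_taut mem_Collect_eq)

text \<open>Were the negation of \<open>A\<close> inconsistent with the formulas boxed in
  \<open>x\<close>, these would derive \<open>A\<close> and force \<open>M A\<close> into
  \<open>x\<close>. A maximal consistent extension is the witness.\<close>

lemma mcs_box_witness:
  assumes "normal_box M" "mcs x" "M A \<notin> x"
  shows "\<exists>y. mcs y \<and> rel M x y \<and> A \<notin> y"
proof -
  have "consistent (insert (\<not>\<^sub>f A) {B. M B \<in> x})"
    unfolding consistent_def
  proof
    assume "derives (insert (\<not>\<^sub>f A) {B. M B \<in> x}) \<bottom>\<^sub>f"
    then have "derives {B. M B \<in> x} (\<not>\<^sub>f A \<rightarrow>\<^sub>f \<bottom>\<^sub>f)"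
      by (rule deduction)
    then have "derives {B. M B \<in> x} A"
      by (rule derives_taut) (simp add: tautology_def)
    then show False
      using assms mcs_box_derives by blast
  qed
  then obtain y where "mcs y" "insert (\<not>\<^sub>f A) {B. M B \<in> x} \<subseteq> y"
    by (rule Lindenbaum)
  then show ?thesis
    unfolding rel_def using mcs_Bot mcs_Imp by (intro exI[of _ y]) auto
qed

end

section \<open>The canonical model of S4DS\<close>

locale S4DS_logic = modal_logic +
  assumes S4D_axioms: "{ax_B_D, ax_4_D, ax_D_Box, ax_T_Box, ax_4_Box} \<subseteq> L"
    and DS_axiom: "ax_DS \<in> L"
begin

lemma mcs_B_D: "mcs x \<Longrightarrow> A \<in> x \<Longrightarrow> [\<noteq>] \<langle>\<noteq>\<rangle> A \<in> x"
  and mcs_4_D: "mcs x \<Longrightarrow> A \<in> x \<Longrightarrow> [\<noteq>] A \<in> x \<Longrightarrow> [\<noteq>] [\<noteq>] A \<in> x"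
  and mcs_D_Box: "mcs x \<Longrightarrow> A \<in> x \<Longrightarrow> [\<noteq>] A \<in> x \<Longrightarrow> \<box> A \<in> x"
  and mcs_T_Box: "mcs x \<Longrightarrow> \<box> A \<in> x \<Longrightarrow> A \<in> x"
  and mcs_4_Box: "mcs x \<Longrightarrow> \<box> A \<in> x \<Longrightarrow> \<box> \<box> A \<in> x"
  and mcs_DS: "mcs x \<Longrightarrow> [\<noteq>] A \<in> x \<Longrightarrow> \<diamond> A \<in> x"
proof -
  assume x: "mcs x"
  \<comment> \<open>Each axiom contains only the letter \<open>P\<close>, so constant substitutions
    yield all the instances.\<close>
  have inst: "subst (\<lambda>_. A) B \<in> x" if "B \<in> L" for B
    using x that subst mcs_theorem by blast
  have ax: "ax_B_D \<in> L" "ax_4_D \<in> L" "ax_D_Box \<in> L" "ax_T_Box \<in> L" "ax_4_Box \<in> L"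
    using S4D_axioms by auto
  note simps = mcs_Imp[OF x] mcs_Bot[OF x]
  show "A \<in> x \<Longrightarrow> [\<noteq>] \<langle>\<noteq>\<rangle> A \<in> x"
    using inst[OF ax(1)] by (simp add: ax_B_D_def simps)
  show "A \<in> x \<Longrightarrow> [\<noteq>] A \<in> x \<Longrightarrow> [\<noteq>] [\<noteq>] A \<in> x"
    using inst[OF ax(2)] by (simp add: ax_4_D_def simps)
  show "A \<in> x \<Longrightarrow> [\<noteq>] A \<in> x \<Longrightarrow> \<box> A \<in> x"
    using inst[OF ax(3)] by (simp add: ax_D_Box_def simps)
  show "\<box> A \<in> x \<Longrightarrow> A \<in> x"
    using inst[OF ax(4)] by (simp add: ax_T_Box_def simps)
  show "\<box> A \<in> x \<Longrightarrow> \<box> \<box> A \<in> x"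
    using inst[OF ax(5)] by (simp add: ax_4_Box_def simps)
  show "[\<noteq>] A \<in> x \<Longrightarrow> \<diamond> A \<in> x"
    using inst[OF DS_axiom] by (simp add: ax_DS_def simps)
qed

lemma rel_Box_refl: "mcs x \<Longrightarrow> rel Box x x"
  unfolding rel_def using mcs_T_Box by blast

lemma rel_Box_trans: "mcs x \<Longrightarrow> rel Box x y \<Longrightarrow> rel Box y z \<Longrightarrow> rel Box x z"
  unfolding rel_def using mcs_4_Box by blast

text \<open>This is the canonical reading of \<open>ax_B_D\<close>: a formula false at
  \<open>x\<close> must be possibly false, in the sense of
  \<open>\<langle>\<noteq>\<rangle>\<close>, at \<open>y\<close>.\<close>

lemma rel_BoxD_sym:
  assumes x: "mcs x" and y: "mcs y" and xy: "rel BoxD x y"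
  shows "rel BoxD y x"
  unfolding rel_def
proof (intro allI impI)
  fix A assume A: "[\<noteq>] A \<in> y"
  show "A \<in> x"
  proof (rule ccontr)
    assume "A \<notin> x"
    then have "[\<noteq>] \<langle>\<noteq>\<rangle> (\<not>\<^sub>f A) \<in> x"
      using x by (intro mcs_B_D) (simp_all add: mcs_Imp)
    then have "\<langle>\<noteq>\<rangle> (\<not>\<^sub>f A) \<in> y"
      using xy unfolding rel_def by blast
    \<comment> \<open>The diamond unfolds to a negated box over a double negation, so
      \<open>[\<noteq>] A\<close> is brought into that form.\<close>
    moreover have "[\<noteq>] \<not>\<^sub>f \<not>\<^sub>f A \<in> y"
      using normal_box(2) y A by (rule mcs_box_taut) (simp add: tautology_def)
    ultimately show False
      using y by (simp add: mcs_Imp mcs_Bot)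
  qed
qed

text \<open>In this lemma and the next, a formula \<open>B\<close> that is in the first but not in the last set
  separates the two, and \<open>\<not> A \<rightarrow> B\<close> serves as the disjunction of \<open>A\<close> and \<open>B\<close>.\<close>

lemma rel_BoxD_weak_trans:
  assumes x: "mcs x" and y: "mcs y" and z: "mcs z"
    and xy: "rel BoxD x y" and yz: "rel BoxD y z" and "x \<noteq> z"
  shows "rel BoxD x z"
  unfolding rel_def
proof (intro allI impI)
  fix A assume A: "[\<noteq>] A \<in> x"
  obtain B where B: "B \<in> x" "B \<notin> z"
    using \<open>x \<noteq> z\<close> x z by (metis mcs_Bot mcs_Imp subsetI subset_antisym)
  have "[\<noteq>] (\<not>\<^sub>f A \<rightarrow>\<^sub>f B) \<in> x"
    using normal_box(2) x A by (rule mcs_box_taut) (simp add: tautology_def)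
  moreover have "(\<not>\<^sub>f A \<rightarrow>\<^sub>f B) \<in> x"
    using x B by (simp add: mcs_Imp)
  ultimately have "[\<noteq>] [\<noteq>] (\<not>\<^sub>f A \<rightarrow>\<^sub>f B) \<in> x"
    using x mcs_4_D by blast
  then have "(\<not>\<^sub>f A \<rightarrow>\<^sub>f B) \<in> z"
    using xy yz unfolding rel_def by blast
  then show "A \<in> z"
    using z B by (auto simp: mcs_Imp mcs_Bot)
qed

lemma rel_Box_imp_BoxD:
  assumes x: "mcs x" and y: "mcs y" and xy: "rel Box x y" and "x \<noteq> y"
  shows "rel BoxD x y"
  unfolding rel_def
proof (intro allI impI)
  fix A assume A: "[\<noteq>] A \<in> x"
  obtain B where B: "B \<in> x" "B \<notin> y"
    using \<open>x \<noteq> y\<close> x y by (metis mcs_Bot mcs_Imp subsetI subset_antisym)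
  have "[\<noteq>] (\<not>\<^sub>f A \<rightarrow>\<^sub>f B) \<in> x"
    using normal_box(2) x A by (rule mcs_box_taut) (simp add: tautology_def)
  moreover have "(\<not>\<^sub>f A \<rightarrow>\<^sub>f B) \<in> x"
    using x B by (simp add: mcs_Imp)
  ultimately have "\<box> (\<not>\<^sub>f A \<rightarrow>\<^sub>f B) \<in> x"
    using x mcs_D_Box by blast
  then have "(\<not>\<^sub>f A \<rightarrow>\<^sub>f B) \<in> y"
    using xy unfolding rel_def by blast
  then show "A \<in> y"
    using y B by (auto simp: mcs_Imp mcs_Bot)
qed

text \<open>A common successor exists once the formulas boxed by either modality are jointly
  consistent. A contradiction would split into \<open>[\<noteq>] C\<close> and \<open>\<box>\<close>
  of the negation of \<open>C\<close>, both in \<open>x\<close>, against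
  \<open>ax_DS\<close>.\<close>

lemma DS_witness:
  assumes x: "mcs x"
  shows "\<exists>y. mcs y \<and> rel Box x y \<and> rel BoxD x y"
proof -
  let ?B = "{A. \<box> A \<in> x}" and ?D = "{A. [\<noteq>] A \<in> x}"
  have "consistent (?B \<union> ?D)"
    unfolding consistent_def
  proof
    assume "derives (?B \<union> ?D) \<bottom>\<^sub>f"
    then obtain As where As: "set As \<subseteq> ?B \<union> ?D" "imps As \<bottom>\<^sub>f \<in> L"
      unfolding derives_def by blast
    define As1 where "As1 = filter (\<lambda>A. A \<in> ?B) As"
    define As2 where "As2 = filter (\<lambda>A. A \<notin> ?B) As"
    \<comment> \<open>The \<open>[\<noteq>]\<close> premises refute the conjunction of the
      \<open>\<box>\<close> premises. The triple negation used below is what remains under the box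
      when the diamond of this formula is unfolded.\<close>
    have "imps As2 (\<not>\<^sub>f \<not>\<^sub>f imps As1 \<bottom>\<^sub>f) \<in> L"
      using As(2) by (rule taut_mp) (auto simp: tautology_def As1_def As2_def)
    moreover have "set As2 \<subseteq> ?D"
      using As(1) by (auto simp: As2_def)
    ultimately have "derives ?D (\<not>\<^sub>f \<not>\<^sub>f imps As1 \<bottom>\<^sub>f)"
      unfolding derives_def by blast
    then have "[\<noteq>] \<not>\<^sub>f \<not>\<^sub>f imps As1 \<bottom>\<^sub>f \<in> x"
      using mcs_box_derives normal_box(2) x by blast
    then have "\<diamond> (\<not>\<^sub>f \<not>\<^sub>f imps As1 \<bottom>\<^sub>f) \<in> x"
      using x mcs_DS by blast
    moreover have "derives ?B (\<not>\<^sub>f \<not>\<^sub>f \<not>\<^sub>f imps As1 \<bottom>\<^sub>f)"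
    proof -
      have "imps As1 (\<not>\<^sub>f \<not>\<^sub>f \<not>\<^sub>f imps As1 \<bottom>\<^sub>f) \<in> L"
        by (rule taut) (auto simp: tautology_def)
      moreover have "set As1 \<subseteq> ?B"
        by (auto simp: As1_def)
      ultimately show ?thesis
        unfolding derives_def by blast
    qed
    then have "\<box> \<not>\<^sub>f \<not>\<^sub>f \<not>\<^sub>f imps As1 \<bottom>\<^sub>f \<in> x"
      using mcs_box_derives normal_box(1) x by blast
    ultimately show False
      using x by (simp add: mcs_Imp mcs_Bot)
  qed
  then obtain y where "mcs y" "?B \<union> ?D \<subseteq> y"
    by (rule Lindenbaum)
  then show ?thesis
    unfolding rel_def by blast
qed

end

section \<open>Countable submodels\<close>

text \<open>The closure consists of the values at \<open>w\<close> of all finite compositions of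
  members of \<open>F\<close>; a countable set has only countably many finite lists.\<close>

lemma countable_closure:
  fixes F :: "('b \<Rightarrow> 'b) set"
  assumes "countable F" "w \<in> S" "\<forall>f\<in>F. \<forall>x\<in>S. f x \<in> S"
  obtains W where "countable W" "w \<in> W" "W \<subseteq> S" "\<forall>f\<in>F. \<forall>x\<in>W. f x \<in> W"
proof
  let ?W = "(\<lambda>fs. foldr (\<lambda>f. f) fs w) ` lists F"
  show "countable ?W"
    using assms(1) by simp
  show "w \<in> ?W"
    by (rule image_eqI[of _ _ "[]"]) auto
  have "foldr (\<lambda>f. f) fs w \<in> S" if "fs \<in> lists F" for fs
    using that assms(2,3) by (induction fs) auto
  then show "?W \<subseteq> S"
    by blast
  show "\<forall>f\<in>F. \<forall>x\<in>?W. f x \<in> ?W"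
  proof (intro ballI)
    fix f x assume f: "f \<in> F" and x: "x \<in> ?W"
    obtain fs where "fs \<in> lists F" "x = foldr (\<lambda>f. f) fs w"
      using x by blast
    then show "f x \<in> ?W"
      using f by (intro image_eqI[of _ _ "f # fs"]) auto
  qed
qed

context S4DS_logic
begin

lemma countable_submodel:
  assumes w: "mcs w"
  obtains W where "countable W" "w \<in> W" "\<forall>x\<in>W. mcs x"
    "\<forall>x\<in>W. \<forall>y\<in>W. x \<noteq> y \<longrightarrow> rel BoxD x y"
    "\<forall>x\<in>W. \<forall>A. \<box> A \<notin> x \<longrightarrow> (\<exists>y\<in>W. rel Box x y \<and> A \<notin> y)"
    "\<forall>x\<in>W. \<forall>A. [\<noteq>] A \<notin> x \<longrightarrow> (\<exists>y\<in>W. rel BoxD x y \<and> A \<notin> y)"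
    "\<forall>x\<in>W. \<exists>y\<in>W. rel Box x y \<and> rel BoxD x y"
proof -
  \<comment> \<open>The component of \<open>w\<close> under the relation of
    \<open>[\<noteq>]\<close>; by symmetry and weak transitivity, distinct points in it are
    related.\<close>
  let ?S = "{x. mcs x \<and> (x = w \<or> rel BoxD w x)}"
  \<comment> \<open>Witness functions, one for each box and formula. When no witness is required,
    the default \<open>x\<close> keeps the value in \<open>?S\<close>.\<close>
  define wit where "wit M A x = (if M A \<in> x then x else SOME y. mcs y \<and> rel M x y \<and> A \<notin> y)"
    for M :: "fm \<Rightarrow> fm" and A x
  define ds where "ds x = (SOME y. mcs y \<and> rel Box x y \<and> rel BoxD x y)" for x
  have wit: "mcs (wit M A x) \<and> rel M x (wit M A x) \<and> A \<notin> wit M A x"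
    if "normal_box M" "mcs x" "M A \<notin> x" for M A x
    using someI_ex[OF mcs_box_witness[OF that]] that(3) by (simp add: wit_def)
  have ds: "mcs (ds x) \<and> rel Box x (ds x) \<and> rel BoxD x (ds x)" if "mcs x" for x
    using someI_ex[OF DS_witness[OF that]] by (simp add: ds_def)
  \<comment> \<open>Weak transitivity fails to apply only when the path returns to \<open>w\<close>,
    which lies in \<open>?S\<close> anyway.\<close>
  have D_closed: "y \<in> ?S" if "x \<in> ?S" "mcs y" "rel BoxD x y" for x y
    using that w rel_BoxD_weak_trans by blast
  have B_closed: "y \<in> ?S" if "x \<in> ?S" "mcs y" "rel Box x y" for x y
    using that D_closed rel_Box_imp_BoxD by blast
  let ?F = "insert ds (range (wit Box) \<union> range (wit BoxD))"
  have F: "countable ?F"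
    by simp
  have S: "w \<in> ?S"
    using w by simp
  have FS: "\<forall>f\<in>?F. \<forall>x\<in>?S. f x \<in> ?S"
  proof (intro ballI)
    fix f x assume f: "f \<in> ?F" and xS: "x \<in> ?S"
    then have x: "mcs x"
      by simp
    have "wit Box A x \<in> ?S" for A
      using wit[OF normal_box(1) x] B_closed[OF xS] xS
      by (cases "\<box> A \<in> x") (simp_all add: wit_def)
    moreover have "wit BoxD A x \<in> ?S" for A
      using wit[OF normal_box(2) x] D_closed[OF xS] xS
      by (cases "[\<noteq>] A \<in> x") (simp_all add: wit_def)
    moreover have "ds x \<in> ?S"
      using ds[OF x] D_closed[OF xS] by blast
    ultimately show "f x \<in> ?S"
      using f by blast
  qed
  obtain W where W: "countable W" "w \<in> W" "W \<subseteq> ?S"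
    and closed: "\<forall>f\<in>?F. \<forall>x\<in>W. f x \<in> W"
    by (rule countable_closure[OF F S FS])
  have mcs: "mcs x" if "x \<in> W" for x
    using that W(3) by blast
  show thesis
  proof (rule that[OF W(1,2)]; intro ballI allI impI)
    show "mcs x" if "x \<in> W" for x
      using that by (rule mcs)
    show "rel BoxD x y" if "x \<in> W" "y \<in> W" "x \<noteq> y" for x y
    proof -
      have "x \<in> ?S" "y \<in> ?S"
        using that W(3) by blast+
      then show ?thesis
        using \<open>x \<noteq> y\<close> w rel_BoxD_sym rel_BoxD_weak_trans by blast
    qed
    show "\<exists>y\<in>W. rel Box x y \<and> A \<notin> y" if "x \<in> W" "\<box> A \<notin> x" for x A
      using wit[OF normal_box(1) mcs] that closed by blast
    show "\<exists>y\<in>W. rel BoxD x y \<and> A \<notin> y" if "x \<in> W" "[\<noteq>] A \<notin> x" for x A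
      using wit[OF normal_box(2) mcs] that closed by blast
    show "\<exists>y\<in>W. rel Box x y \<and> rel BoxD x y" if "x \<in> W" for x
      using ds[OF mcs] that closed by blast
  qed
qed

end

section \<open>The topological model\<close>

text \<open>For a preorder this is its Alexandrov topology.\<close>

definition upset_topology :: "'a set \<Rightarrow> ('a \<Rightarrow> 'a \<Rightarrow> bool) \<Rightarrow> 'a topology" where
  "upset_topology C R = topology (\<lambda>U. U \<subseteq> C \<and> (\<forall>x\<in>U. \<forall>y\<in>C. R x y \<longrightarrow> y \<in> U))"

lemma openin_upset_topology:
  "openin (upset_topology C R) U \<longleftrightarrow> U \<subseteq> C \<and> (\<forall>x\<in>U. \<forall>y\<in>C. R x y \<longrightarrow> y \<in> U)"
proof -
  have "istopology (\<lambda>U. U \<subseteq> C \<and> (\<forall>x\<in>U. \<forall>y\<in>C. R x y \<longrightarrow> y \<in> U))"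
    unfolding istopology_def by blast
  then show ?thesis
    by (simp add: upset_topology_def topology_inverse')
qed

lemma topspace_upset_topology [simp]: "topspace (upset_topology C R) = C"
  by (rule antisym) (auto simp: topspace_def openin_upset_topology)

text \<open>The successors of \<open>x\<close> form its least neighbourhood, so topological and
  relational truth of \<open>\<box>\<close> agree.\<close>

lemma ex_nbhd_upset_topology:
  assumes "x \<in> C" and refl: "R x x"
    and trans: "\<And>y z. y \<in> C \<Longrightarrow> z \<in> C \<Longrightarrow> R x y \<Longrightarrow> R y z \<Longrightarrow> R x z"
  shows "(\<exists>U. nbhd (upset_topology C R) x U \<and> (\<forall>y\<in>U. \<phi> y)) \<longleftrightarrow> (\<forall>y\<in>C. R x y \<longrightarrow> \<phi> y)"
proof
  assume "\<exists>U. nbhd (upset_topology C R) x U \<and> (\<forall>y\<in>U. \<phi> y)"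
  then show "\<forall>y\<in>C. R x y \<longrightarrow> \<phi> y"
    unfolding nbhd_def openin_upset_topology by blast
next
  assume *: "\<forall>y\<in>C. R x y \<longrightarrow> \<phi> y"
  have "openin (upset_topology C R) {y \<in> C. R x y}"
    unfolding openin_upset_topology using trans by blast
  then have "nbhd (upset_topology C R) x {y \<in> C. R x y}"
    unfolding nbhd_def topspace_upset_topology using \<open>x \<in> C\<close> refl by blast
  then show "\<exists>U. nbhd (upset_topology C R) x U \<and> (\<forall>y\<in>U. \<phi> y)"
    using * by blast
qed

text \<open>Points that are reflexive for \<open>D\<close> get two preimages, the others one.\<close>

lemma ex_doubling:
  assumes inf: "infinite (UNIV :: 'a set)" and "countable W"
    and D: "\<forall>x\<in>W. \<forall>y\<in>W. x \<noteq> y \<longrightarrow> D x y"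
  obtains C :: "'a set" and g where "g ` C = W"
    "\<forall>c\<in>C. \<forall>y\<in>W. D (g c) y \<longleftrightarrow> (\<exists>d\<in>C. d \<noteq> c \<and> g d = y)"
proof -
  \<comment> \<open>The flag \<open>b\<close> marks the second copy. The set of pairs is then
    embedded into the given type through the natural numbers.\<close>
  let ?V = "{(x, b). x \<in> W \<and> (b \<longrightarrow> D x x)}"
  have "countable (W \<times> (UNIV :: bool set))"
    using assms(2) by auto
  then have "countable ?V"
    by (rule countable_subset[rotated]) auto
  then obtain e :: "_ \<Rightarrow> nat" where e: "inj_on e ?V"
    by (rule countableE)
  obtain h :: "nat \<Rightarrow> 'a" where h: "inj h"
    using infinite_countable_subset[OF inf] by blast
  have inj: "inj_on (h \<circ> e) ?V"
    using e h by (meson comp_inj_on inj_on_subset subset_UNIV)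
  define i where "i = inv_into ?V (h \<circ> e)"
  have i: "i ((h \<circ> e) v) = v" if "v \<in> ?V" for v
    unfolding i_def using inj that by (rule inv_into_f_f)
  let ?C = "(h \<circ> e) ` ?V"
  show thesis
  proof (rule that[of "fst \<circ> i" ?C]; (intro ballI)?)
    have "(fst \<circ> i) ` ?C = fst ` ?V"
      unfolding image_comp by (rule image_cong) (use i in auto)
    also have "\<dots> = W"
      by force
    finally show "(fst \<circ> i) ` ?C = W" .
    fix c y assume "c \<in> ?C" and y: "y \<in> W"
    then obtain x b where v: "(x, b) \<in> ?V" and c: "c = (h \<circ> e) (x, b)"
      by blast
    have "(\<exists>d\<in>?C. d \<noteq> c \<and> (fst \<circ> i) d = y) \<longleftrightarrow> (\<exists>u\<in>?V. u \<noteq> (x, b) \<and> fst u = y)"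
    proof -
      have "(h \<circ> e) u = c \<longleftrightarrow> u = (x, b)" if "u \<in> ?V" for u
        unfolding c using inj_on_eq_iff[OF inj that v] .
      moreover have "(fst \<circ> i) ((h \<circ> e) u) = fst u" if "u \<in> ?V" for u
        using i[OF that] by simp
      ultimately show ?thesis
        unfolding bex_simps(7) by (intro bex_cong refl) simp
    qed
    also have "\<dots> \<longleftrightarrow> D x y"
    proof
      assume "\<exists>u\<in>?V. u \<noteq> (x, b) \<and> fst u = y"
      then obtain b' where "(y, b') \<in> ?V" "(y, b') \<noteq> (x, b)"
        by auto
      \<comment> \<open>Over one point, two distinct pairs differ in the flag, so one of them is a
        second copy and \<open>x\<close> is reflexive.\<close>
      then show "D x y"
        using D v by (cases "x = y") auto
    next
      assume "D x y"
      \<comment> \<open>For \<open>y = x\<close> the other copy is chosen, which exists by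
        reflexivity; over any other point the first copy will do.\<close>
      then have "(y, if y = x then \<not> b else False) \<in> ?V"
        using y by auto
      then show "\<exists>u\<in>?V. u \<noteq> (x, b) \<and> fst u = y"
        by (rule bexI[rotated]) auto
    qed
    also have "D x y \<longleftrightarrow> D ((fst \<circ> i) c) y"
      using i[OF v] c by simp
    finally show "D ((fst \<circ> i) c) y \<longleftrightarrow> (\<exists>d\<in>?C. d \<noteq> c \<and> (fst \<circ> i) d = y)" ..
  qed
qed

section \<open>Completeness\<close>

lemma (in S4DS_logic) complete:
  assumes inf: "infinite (UNIV :: 'a set)" and "A \<notin> L"
  shows "\<exists>X :: 'a topology. dense_in_itself X \<and> \<not> valid_in X A"
proof -
  have "consistent {\<not>\<^sub>f A}"
    unfolding consistent_def
  proof
    assume "derives {\<not>\<^sub>f A} \<bottom>\<^sub>f"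
    then have "derives {} A"
      using deduction[of "\<not>\<^sub>f A" "{}"] derives_taut[of "{}" "\<not>\<^sub>f \<not>\<^sub>f A" A]
      by (simp add: tautology_def)
    then show False
      using \<open>A \<notin> L\<close> unfolding derives_def by simp
  qed
  then obtain w where w: "mcs w" "A \<notin> w"
    using Lindenbaum mcs_Imp mcs_Bot by (metis insert_subset)
  obtain W where W: "countable W" "w \<in> W" and mcs: "\<forall>x\<in>W. mcs x"
    and D: "\<forall>x\<in>W. \<forall>y\<in>W. x \<noteq> y \<longrightarrow> rel BoxD x y"
    and wit_Box: "\<forall>x\<in>W. \<forall>A. \<box> A \<notin> x \<longrightarrow> (\<exists>y\<in>W. rel Box x y \<and> A \<notin> y)"
    and wit_BoxD: "\<forall>x\<in>W. \<forall>A. [\<noteq>] A \<notin> x \<longrightarrow> (\<exists>y\<in>W. rel BoxD x y \<and> A \<notin> y)"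
    and wit_DS: "\<forall>x\<in>W. \<exists>y\<in>W. rel Box x y \<and> rel BoxD x y"
    by (rule countable_submodel[OF w(1)])
  obtain C :: "'a set" and g where g: "g ` C = W"
    and ineq: "\<forall>c\<in>C. \<forall>y\<in>W. rel BoxD (g c) y \<longleftrightarrow> (\<exists>d\<in>C. d \<noteq> c \<and> g d = y)"
    by (rule ex_doubling[OF inf W(1) D])
  have gW: "g c \<in> W" if "c \<in> C" for c
    using g that by blast
  \<comment> \<open>The order is pulled back along \<open>g\<close>, so two copies of a point lie
    below each other.\<close>
  let ?R = "\<lambda>c d. rel Box (g c) (g d)"
  define X where "X = upset_topology C ?R"
  define \<theta> where "\<theta> p = {c \<in> C. Letter p \<in> g c}" for p
  \<comment> \<open>The truth lemma. Surjectivity of \<open>g\<close> onto \<open>W\<close>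
    transfers the successors of \<open>\<box>\<close>, and the doubling makes inequality in
    \<open>C\<close> match the relation of \<open>[\<noteq>]\<close>.\<close>
  have truth: "holds X \<theta> c B \<longleftrightarrow> B \<in> g c" if "c \<in> C" for c B
    using that
  proof (induction B arbitrary: c)
    case (Letter p)
    then show ?case
      by (simp add: \<theta>_def)
  next
    case Bot
    then show ?case
      using mcs_Bot mcs gW by auto
  next
    case (Imp B1 B2)
    then show ?case
      using mcs_Imp mcs gW by auto
  next
    case (Box B)
    have "holds X \<theta> c (\<box> B) \<longleftrightarrow> (\<forall>d\<in>C. ?R c d \<longrightarrow> holds X \<theta> d B)"
      unfolding X_def holds.simps
      using Box.prems mcs gW rel_Box_refl rel_Box_trans by (intro ex_nbhd_upset_topology) blast+
    also have "\<dots> \<longleftrightarrow> (\<forall>d\<in>C. ?R c d \<longrightarrow> B \<in> g d)"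
      using Box.IH by blast
    also have "\<dots> \<longleftrightarrow> (\<forall>y\<in>W. rel Box (g c) y \<longrightarrow> B \<in> y)"
      using g by blast
    also have "\<dots> \<longleftrightarrow> \<box> B \<in> g c"
      using wit_Box[rule_format, OF gW[OF Box.prems], of B] unfolding rel_def by blast
    finally show ?case .
  next
    case (BoxD B)
    have "rel BoxD (g c) y \<longleftrightarrow> (\<exists>d\<in>C. d \<noteq> c \<and> g d = y)" if "y \<in> W" for y
      using ineq BoxD.prems that by blast
    then have succ: "{y \<in> W. rel BoxD (g c) y} = g ` (C - {c})"
      using gW by auto
    have "holds X \<theta> c ([\<noteq>] B) \<longleftrightarrow> (\<forall>d\<in>C. d \<noteq> c \<longrightarrow> B \<in> g d)"
      using BoxD.IH by (simp add: X_def)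
    also have "\<dots> \<longleftrightarrow> (\<forall>y\<in>{y \<in> W. rel BoxD (g c) y}. B \<in> y)"
      unfolding succ by blast
    also have "\<dots> \<longleftrightarrow> [\<noteq>] B \<in> g c"
      using wit_BoxD[rule_format, OF gW[OF BoxD.prems], of B] unfolding rel_def by blast
    finally show ?case .
  qed
  have "dense_in_itself X"
    unfolding dense_in_itself_def isolated_pt_def
  proof
    assume "\<exists>c. c \<in> topspace X \<and> openin X {c}"
    then obtain c where c: "c \<in> C" and "openin X {c}"
      by (auto simp: X_def)
    \<comment> \<open>Being also a \<open>[\<noteq>]\<close> successor, \<open>y\<close> has a
      preimage other than \<open>c\<close>, even if \<open>y = g c\<close>; it lies in every open
      set around \<open>c\<close>.\<close>
    moreover obtain y where y: "y \<in> W" "rel Box (g c) y" "rel BoxD (g c) y"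
      using wit_DS gW c by blast
    moreover from y(3) obtain d where "d \<in> C" "d \<noteq> c" "?R c d"
      using bspec[OF bspec[OF ineq c] y(1)] y(2) by auto
    ultimately show False
      by (auto simp: X_def openin_upset_topology)
  qed
  moreover have "\<not> valid_in X A"
  proof -
    obtain c where "c \<in> C" "g c = w"
      using g W(2) by blast
    moreover have "valuation X \<theta>"
      by (auto simp: valuation_def X_def \<theta>_def)
    ultimately show ?thesis
      using truth w(2) unfolding valid_in_def by (auto simp: X_def)
  qed
  ultimately show ?thesis
    by blast
qed

theorem theorem6p8:
  assumes "infinite (UNIV :: 'a set)"
  shows "S4DS = D_logic {X :: 'a topology. dense_in_itself X}"
proof
  show "S4DS \<subseteq> D_logic {X :: 'a topology. dense_in_itself X}"
    by (rule S4DS_sound)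
  \<comment> \<open>The canonical construction is applied to the least logic with these axioms;
    every formula outside it is then refuted in a space over the given type.\<close>
  interpret S4DS_logic S4DS
  proof
    show "bimodal_logic S4DS"
      unfolding S4DS_def by (rule bimodal_logic_extend)
    show "{ax_B_D, ax_4_D, ax_D_Box, ax_T_Box, ax_4_Box} \<subseteq> S4DS"
      unfolding S4DS_def S4D_def by (rule subset_trans[OF extend_upper(2) extend_upper(1)])
    show "ax_DS \<in> S4DS"
      unfolding S4DS_def by (rule subsetD[OF extend_upper(2)]) simp
  qed
  show "D_logic {X :: 'a topology. dense_in_itself X} \<subseteq> S4DS"
    unfolding D_logic_def using complete[OF assms] by blast
qed

end
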